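(* Assume that $K$ admits a reversible probability $\eta$ on $S$, i.e. $\eta(x)\bar L(x,y)=\eta(y)\bar L(y,x)$ for all $x,y\in S$. Let $N$ be the cardinality of $S$ and let $\lambda_0<\lambda_1\le\lambda_2\le\cdots\le\lambda_{N-1}$ be the eigenvalues of $-K$ (counted with multiplicity). Then $$a_\varphi\le\left(\Big(1-\frac{\lambda_0}{\lambda_0'}\Big)\prod_{k=1}^{N-1}\Big(1-\frac{\lambda_0}{\lambda_k}\Big)\right)^{-1}.$$
   Context: Setting: $S$ is a finite nonempty set, $\bar S:=S\sqcup\{\infty\}$, and $\bar L=(\bar L(x,y))_{x,y\in\bar S}$ is a Markov generator matrix (off-diagonal entries non-negative, each row sums to $0$). Its restriction $K$ to $S\times S$ is irreducible, $\bar L(\infty,x)=0$ for all $x\in\bar S$ (so $\infty$ is absorbing), and there exists $x\in S$ with $\bar L(x,\infty)>0$. By Perron-Frobenius, $-K$ has a unique eigenvalue $\lambda_0$ admitting a positive eigenvector; it is simple, and under reversibility it is the smallest eigenvalue of the diagonalizable operator $-K$. Let $\varphi:S\to(0,\infty)$ be such an eigenvector: $K\varphi=-\lambda_0\varphi$. Its amplitude is $a_\varphi:=\max_{x\in S}\varphi(x)/\min_{x\in S}\varphi(x)$. For $x\in S$, $\lambda_0(S\setminus\{x\})$ denotes the first (smallest) eigenvalue of the $(S\setminus\{x\})\times(S\setminus\{x\})$ minor of $-\bar L$ (i.e. the submatrix indexed by $S\setminus\{x\}$), with the convention $\lambda_0(\emptyset)=+\infty$. With $O:=\{x\in S : \bar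 L(x,\infty)>0\}$, set $\lambda_0':=\min_{x\in O}\lambda_0(S\setminus\{x\})$. *)

theory Defs
  imports "HOL-Analysis.Analysis" "HOL-Computational_Algebra.Polynomial"
begin

text \<open>
  The finite nonempty set \<open>S\<close> is the universe of a type \<open>'a :: finite\<close>; the extended set
  \<open>S \<squnion> {\<infinity>}\<close> is \<open>'a option\<close>, with \<open>None\<close> in the role of \<open>\<infinity>\<close>.
\<close>

definition markov_generator :: "real ^ 'n ^ 'n \<Rightarrow> bool" where
  "markov_generator L \<longleftrightarrow>
     (\<forall>x y. x \<noteq> y \<longrightarrow> 0 \<le> L $ x $ y) \<and> (\<forall>x. (\<Sum>y\<in>UNIV. L $ x $ y) = 0)"

definition restriction :: "real ^ ('a::finite option) ^ ('a option) \<Rightarrow> real ^ 'a ^ 'a" where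
  "restriction L = (\<chi> x y. L $ Some x $ Some y)"

text \<open>The closure is reflexive, so a \<open>1 \<times> 1\<close> matrix is irreducible, whatever its entry.\<close>

definition irreducible_matrix :: "real ^ 'n ^ 'n \<Rightarrow> bool" where
  "irreducible_matrix A \<longleftrightarrow> (\<forall>x y. (x, y) \<in> {(u, v). u \<noteq> v \<and> A $ u $ v > 0}\<^sup>*)"

definition reversible_probability :: "real ^ 'n ^ 'n \<Rightarrow> ('n \<Rightarrow> real) \<Rightarrow> bool" where
  "reversible_probability A \<eta> \<longleftrightarrow>
     (\<forall>x. 0 \<le> \<eta> x) \<and> (\<Sum>x\<in>UNIV. \<eta> x) = 1 \<and> (\<forall>x y. \<eta> x * A $ x $ y = \<eta> y * A $ y $ x)"

definition charpoly :: "real ^ 'n ^ 'n \<Rightarrow> real poly" where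
  "charpoly A = det (\<chi> i j. (if i = j then [:0, 1:] else 0) - [:A $ i $ j:])"

text \<open>
  The real eigenvalues, repeated according to (algebraic) multiplicity, in nondecreasing order;
  \<open>sorted_eigenvalues A ! k\<close> is \<open>\<lambda>\<^sub>k\<close>. If \<open>A\<close> is diagonalizable over the reals, as it is under
  reversibility, these are all the eigenvalues, the list has length \<open>CARD('n)\<close>, and algebraic and
  geometric multiplicities agree.
\<close>

definition sorted_eigenvalues :: "real ^ 'n ^ 'n \<Rightarrow> real list" where
  "sorted_eigenvalues A = sorted_list_of_multiset (proots (charpoly A))"

definition minor_eigenvalue :: "real ^ 'n ^ 'n \<Rightarrow> 'n set \<Rightarrow> real \<Rightarrow> bool" where
  "minor_eigenvalue A T \<mu> \<longleftrightarrow>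
     (\<exists>f. (\<exists>x\<in>T. f x \<noteq> 0) \<and> (\<forall>x\<in>T. (\<Sum>y\<in>T. A $ x $ y * f y) = \<mu> * f x))"

text \<open>
  The least real eigenvalue of the \<open>T \<times> T\<close> submatrix of \<open>A\<close>. It is used only for \<open>A = - K\<close> with
  \<open>K\<close> having nonnegative off-diagonal entries: then real eigenvalues exist for \<open>T \<noteq> {}\<close>, and by
  Perron-Frobenius the least one also minimises the real part over all complex eigenvalues.
\<close>

definition first_eigenvalue :: "real ^ 'n ^ 'n \<Rightarrow> 'n set \<Rightarrow> ereal" where
  "first_eigenvalue A T = (if T = {} then \<infinity> else ereal (Min {\<mu>. minor_eigenvalue A T \<mu>}))"

definition exit_points :: "real ^ ('a::finite option) ^ ('a option) \<Rightarrow> 'a set" where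
  "exit_points L = {x. L $ Some x $ None > 0}"

text \<open>
  The minor of \<open>- L\<close> on \<open>S - {x}\<close> is a minor of \<open>- restriction L\<close>. The value is \<open>\<infinity>\<close> exactly when
  \<open>S\<close> is a singleton.
\<close>

definition lambda0' :: "real ^ ('a::finite option) ^ ('a option) \<Rightarrow> ereal" where
  "lambda0' L = (MIN x\<in>exit_points L. first_eigenvalue (- restriction L) (UNIV - {x}))"

definition amplitude :: "real ^ 'a \<Rightarrow> real" where
  "amplitude \<phi> = (MAX x. \<phi> $ x) / (MIN x. \<phi> $ x)"

end

theory Submission
  imports Defs
begin

text \<open>
  Write \<open>A = - K\<close> and \<open>c = A 1\<close>, the vector of killing rates, which is nonnegative and not zero.
  Set \<open>P = \<Sum>x. \<eta> x * (\<phi> x)\<^sup>2\<close> and \<open>Q = \<Sum>x. \<eta> x * \<phi> x\<close>. The ratio \<open>P / Q\<close> lies between the least and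
  the greatest value of \<open>\<phi>\<close>, and the amplitude is bounded by comparing each of them with it: the
  greatest value costs the factors \<open>1 - \<lambda>\<^sub>0 / \<lambda>\<^sub>k\<close> and the least value the factor \<open>1 - \<lambda>\<^sub>0 / \<lambda>\<^sub>0'\<close>.

  Upper bound, \<open>\<phi> x * Q * (\<Prod>k\<ge>1. 1 - \<lambda>\<^sub>0 / \<lambda>\<^sub>k) \<le> P\<close> (\<open>eigenvector_max_bound\<close>). Let \<open>D t x\<close> be
  the Cramer determinant for the component \<open>x\<close> of the solution of \<open>(A - t) f = c\<close>, that is, the
  determinant of \<open>A - t\<close> with column \<open>x\<close> replaced by \<open>c\<close>. At \<open>t = 0\<close> the solution is constantly 1,
  so \<open>D 0 x = det A = \<Prod>k. \<lambda>\<^sub>k\<close>. For \<open>t < \<lambda>\<^sub>0\<close> the matrix \<open>A - t\<close> is a nonsingular M-matrix, and for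
  such matrices Cramer determinants with nonnegative right-hand side decrease when a diagonal entry
  decreases (\<open>m_matrix_cramer_diagonal_mono\<close>): the derivative in that entry is a Cramer determinant
  of another M-matrix, hence nonnegative. Hence \<open>D \<lambda>\<^sub>0 x \<le> D 0 x\<close>. On the other hand \<open>(A - t) (D t) = det (A - t) c\<close>
  vanishes at \<open>t = \<lambda>\<^sub>0\<close>, so \<open>D \<lambda>\<^sub>0\<close> is a multiple of \<open>\<phi>\<close>; pairing this identity with \<open>\<eta> \<phi>\<close> gives the
  multiple, \<open>\<lambda>\<^sub>0 * (\<Prod>k\<ge>1. \<lambda>\<^sub>k - \<lambda>\<^sub>0) * Q / P\<close>. Comparing the two values of \<open>D\<close> is the bound.

  Lower bound, \<open>(1 - \<lambda>\<^sub>0 / \<lambda>\<^sub>0') * P \<le> \<phi> y * Q\<close> at a minimum point \<open>y\<close> of \<open>\<phi>\<close>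
  (\<open>eigenvector_min_bound\<close>). The function \<open>\<phi> - \<phi> y\<close> vanishes at \<open>y\<close>, so it is a test function for the
  variational characterisation of the first eigenvalue of the minor on \<open>S - {y}\<close>; the killing term
  has a favourable sign. The eigenvalue equation at \<open>y\<close> forces the killing rate there to be at least
  \<open>\<lambda>\<^sub>0 > 0\<close>, so \<open>y\<close> is an exit point and its minor is one of those that define \<open>\<lambda>\<^sub>0'\<close>.

  Finally the product of the two factors has to be positive before it can be inverted. This is
  \<open>\<lambda>\<^sub>0 < \<lambda>\<^sub>0'\<close>, a maximum principle (\<open>minor_eigenvalue_lower_bound\<close>), and the algebraic simplicity of
  \<open>\<lambda>\<^sub>0\<close> (\<open>principal_root_simple\<close>).
\<close>

section \<open>Determinants of M-matrices\<close>

definition z_matrix :: "real ^ 'n ^ 'n \<Rightarrow> bool" where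
  "z_matrix B \<longleftrightarrow> (\<forall>i j. i \<noteq> j \<longrightarrow> B $ i $ j \<le> 0)"

definition replace_column :: "real ^ 'n ^ 'n \<Rightarrow> 'n \<Rightarrow> real ^ 'n \<Rightarrow> real ^ 'n ^ 'n" where
  "replace_column B k b = (\<chi> i j. if j = k then b $ i else B $ i $ j)"

definition diag_matrix :: "real ^ 'n \<Rightarrow> real ^ 'n ^ 'n" where
  "diag_matrix d = (\<chi> i j. if i = j then d $ i else 0)"

lemma matrix_vector_nth: "(B *v f) $ i = (\<Sum>j\<in>UNIV. B $ i $ j * f $ j)"
  by (simp add: matrix_vector_mult_def)

lemma z_matrix_row_touching:
  assumes "z_matrix B" and "\<And>j. 0 \<le> g $ j" and "g $ i = 0"
  shows "(B *v g) $ i \<le> 0"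
  unfolding matrix_vector_nth
proof (rule sum_nonpos)
  fix j
  show "B $ i $ j * g $ j \<le> 0"
    using assms by (cases "i = j") (auto simp: z_matrix_def mult_nonpos_nonneg)
qed

text \<open>
  Subtracting from \<open>f\<close> the largest multiple of \<open>\<psi>\<close> that stays below it leaves a nonnegative vector
  with a zero, to which \<open>z_matrix_row_touching\<close> applies. All maximum principles below start this way.
\<close>

lemma minimal_ratio:
  fixes f \<psi> :: "real ^ 'n"
  assumes "\<And>i. 0 < \<psi> $ i"
  obtains i m where "f $ i = m * \<psi> $ i" and "\<And>j. m * \<psi> $ j \<le> f $ j"
proof -
  have "\<exists>i. \<forall>j. f $ i / \<psi> $ i \<le> f $ j / \<psi> $ j"
    using ex_is_arg_min_if_finite[of UNIV "\<lambda>i. f $ i / \<psi> $ i"]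
    by (auto simp: is_arg_min_linorder)
  then obtain i where "\<And>j. f $ i / \<psi> $ i \<le> f $ j / \<psi> $ j"
    by blast
  then have "\<And>j. (f $ i / \<psi> $ i) * \<psi> $ j \<le> f $ j"
    using assms by (simp add: pos_le_divide_eq)
  moreover have "f $ i = (f $ i / \<psi> $ i) * \<psi> $ i"
    using assms[of i] by simp
  ultimately show thesis
    using that by blast
qed

text \<open>
  The positive vector \<open>\<psi>\<close> with positive image is what makes a Z-matrix a nonsingular M-matrix. If the
  largest multiple \<open>m * \<psi>\<close> below \<open>f\<close> had \<open>m < 0\<close>, then \<open>B f\<close> would be negative at the touching point.
\<close>

lemma m_matrix_inverse_positive:
  fixes B :: "real ^ 'n ^ 'n"
  assumes B: "z_matrix B" and pos: "\<And>i. 0 < \<psi> $ i" and Bpos: "\<And>i. 0 < (B *v \<psi>) $ i"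
    and f: "\<And>i. 0 \<le> (B *v f) $ i"
  shows "0 \<le> f $ i"
proof -
  obtain k m where k: "f $ k = m * \<psi> $ k" and le: "\<And>j. m * \<psi> $ j \<le> f $ j"
    using minimal_ratio[OF pos] by blast
  have "(B *v (f - m *\<^sub>R \<psi>)) $ k \<le> 0"
    using z_matrix_row_touching[OF B] k le by simp
  then have "(B *v f) $ k \<le> m * (B *v \<psi>) $ k"
    by (simp add: matrix_vector_mult_diff_distrib matrix_vector_mult_scaleR)
  then have "0 \<le> m"
    using f[of k] Bpos[of k] by (meson order_trans zero_le_mult_iff not_le)
  then show ?thesis
    using le[of i] pos[of i] by (meson order_trans mult_nonneg_nonneg less_imp_le)
qed

lemma m_matrix_det_nonzero:
  fixes B :: "real ^ 'n ^ 'n"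
  assumes "z_matrix B" and "\<And>i. 0 < \<psi> $ i" and "\<And>i. 0 < (B *v \<psi>) $ i"
  shows "det B \<noteq> 0"
proof -
  have "f = 0" if "B *v f = 0" for f
  proof -
    have "0 \<le> f $ i" "0 \<le> (- f) $ i" for i
      using m_matrix_inverse_positive[OF assms, of f i] m_matrix_inverse_positive[OF assms, of "- f" i]
        matrix_vector_mult_diff_distrib[of B 0 f] that by simp_all
    then show ?thesis
      by (simp add: vec_eq_iff order_antisym)
  qed
  then have "invertible B"
    by (simp add: invertible_left_inverse matrix_left_invertible_ker)
  then show ?thesis
    by (simp add: invertible_det_nz)
qed

lemma continuous_on_det:
  fixes M :: "real \<Rightarrow> real ^ 'n ^ 'n"
  assumes "\<And>i j. continuous_on S (\<lambda>t. M t $ i $ j)"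
  shows "continuous_on S (\<lambda>t. det (M t))"
  unfolding det_def by (intro continuous_on_sum continuous_on_mult continuous_on_prod continuous_on_const assms)

text \<open>
  The segment from the identity to \<open>B\<close> consists of Z-matrices with the same positive vector \<open>\<psi>\<close>, so the
  determinant cannot change sign along it.
\<close>

lemma m_matrix_det_pos:
  fixes B :: "real ^ 'n ^ 'n"
  assumes B: "z_matrix B" and pos: "\<And>i. 0 < \<psi> $ i" and Bpos: "\<And>i. 0 < (B *v \<psi>) $ i"
  shows "0 < det B"
proof (rule ccontr)
  assume neg: "\<not> 0 < det B"
  define M where "M t = (1 - t) *\<^sub>R mat 1 + t *\<^sub>R B" for t
  have "continuous_on {0..1} (\<lambda>t. det (M t))"
    unfolding M_def by (intro continuous_on_det) (auto intro!: continuous_intros)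
  moreover have "det (M 1) \<le> 0" "0 \<le> det (M 0)"
    using neg by (simp_all add: M_def)
  ultimately obtain t where t: "0 \<le> t" "t \<le> 1" "det (M t) = 0"
    using IVT2'[of "\<lambda>t. det (M t)" 1 0 0] by force
  have "z_matrix (M t)"
    using B t by (auto simp: z_matrix_def M_def mat_def mult_nonneg_nonpos)
  moreover have "0 < (M t *v \<psi>) $ i" for i
  proof -
    have "(M t *v \<psi>) $ i = (1 - t) * \<psi> $ i + t * (B *v \<psi>) $ i"
      by (simp add: M_def matrix_vector_mult_add_rdistrib scaleR_matrix_vector_assoc[symmetric])
    also have "0 < \<dots>"
      using t pos[of i] Bpos[of i] by (cases "t = 0") (auto intro: add_nonneg_pos)
    finally show ?thesis .
  qed
  ultimately show False
    using m_matrix_det_nonzero pos t by blast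
qed

lemma det_replace_column_image: "det (replace_column B k (B *v x)) = x $ k * det B"
  using cramer_lemma[of k B x] by (simp add: replace_column_def)

lemma solve_linear_system:
  fixes B :: "real ^ 'n ^ 'n"
  assumes "det B \<noteq> 0"
  obtains f where "B *v f = b"
  using assms cramer[of B] by blast

text \<open>
  By Cramer's rule the determinant is \<open>det B\<close> times a component of the solution of \<open>B f = b\<close>, and both
  factors are nonnegative.
\<close>

lemma m_matrix_cramer_nonneg:
  fixes B :: "real ^ 'n ^ 'n"
  assumes "z_matrix B" and "\<And>i. 0 < \<psi> $ i" and "\<And>i. 0 < (B *v \<psi>) $ i"
    and "\<And>i. 0 \<le> b $ i"
  shows "0 \<le> det (replace_column B k b)"
proof -
  obtain f where f: "B *v f = b"
    using solve_linear_system[OF m_matrix_det_nonzero[OF assms(1-3)]] by blast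
  then have "0 \<le> f $ k"
    using m_matrix_inverse_positive[OF assms(1-3)] assms(4) by blast
  moreover have "0 < det B"
    using m_matrix_det_pos[OF assms(1-3)] .
  ultimately show ?thesis
    using det_replace_column_image[of B k f] f by simp
qed

lemma det_column_linear:
  fixes M :: "real ^ 'n ^ 'n"
  shows "det (replace_column M k (a - t *\<^sub>R b)) =
    det (replace_column M k a) - t * det (replace_column M k b)"
proof -
  have row: "det (replace_column M k v) = det (\<chi> i. if i = k then v else transpose M $ i)" for v
    by (subst det_transpose[symmetric])
       (auto intro!: arg_cong[of _ _ det] simp: replace_column_def transpose_def vec_eq_iff)
  have "det (replace_column M k (a + (- t) *s b)) =
      det (replace_column M k a) + (- t) * det (replace_column M k b)"
    unfolding row by (simp only: det_row_add det_row_mul)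
  then show ?thesis
    by (simp add: scalar_mult_eq_scaleR)
qed

text \<open>
  A Cramer determinant is affine in each diagonal entry of the matrix. Its slope in the entry \<open>z\<close> is
  the determinant with column \<open>z\<close> replaced by the unit vector at \<open>z\<close>, again a Cramer determinant of
  an M-matrix. So the entries can be lowered one after the other, each step decreasing the
  determinant.
\<close>

lemma m_matrix_cramer_diagonal_mono:
  fixes B :: "real ^ 'n ^ 'n"
  assumes B: "z_matrix B" and d: "\<And>i. 0 \<le> d $ i"
    and pos: "\<And>i. 0 < \<psi> $ i" and Bpos: "\<And>i. 0 < ((B - diag_matrix d) *v \<psi>) $ i"
    and c: "\<And>i. 0 \<le> c $ i"
  shows "det (replace_column (B - diag_matrix d) k c) \<le> det (replace_column B k c)"
proof -
  define M where "M Z = B - diag_matrix (\<chi> i. if i \<in> Z then d $ i else 0)" for Z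
  have "det (replace_column (M Z) k c) \<le> det (replace_column B k c)" if "finite Z" for Z
    using that
  proof (induction Z rule: finite_induct)
    case empty
    have "M {} = B"
      by (simp add: M_def diag_matrix_def vec_eq_iff)
    then show ?case
      by simp
  next
    case (insert z Z)
    show ?case
    proof (cases "z = k")
      case True
      then have "replace_column (M (insert z Z)) k c = replace_column (M Z) k c"
        by (auto simp: replace_column_def M_def diag_matrix_def vec_eq_iff)
      then show ?thesis
        using insert.IH by simp
    next
      case False
      define N where "N = replace_column (M Z) k c"
      define U where "U = replace_column (M Z) z (axis z 1)"
      have new: "replace_column (M (insert z Z)) k c =
          replace_column N z (column z N - d $ z *\<^sub>R axis z 1)"
        using False insert.hyps
        by (auto simp: N_def replace_column_def M_def diag_matrix_def vec_eq_iff column_def axis_def)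
      have old: "replace_column N z (column z N) = N"
        by (simp add: replace_column_def column_def vec_eq_iff)
      have swap: "replace_column N z (axis z 1) = replace_column U k c"
        using False by (auto simp: N_def U_def replace_column_def vec_eq_iff)
      have "0 \<le> det (replace_column U k c)"
      proof (rule m_matrix_cramer_nonneg)
        have offdiag: "M Z $ i $ j \<le> 0" if "i \<noteq> j" for i j
          using B that by (simp add: z_matrix_def M_def diag_matrix_def)
        show "z_matrix U"
          using offdiag by (auto simp: z_matrix_def U_def replace_column_def axis_def)
        define s where "s = (\<Sum>j\<in>UNIV - {z}. M Z $ z $ j * \<psi> $ j)"
        \<comment> \<open>Row \<open>z\<close> of \<open>U\<close> can be made positive, since its diagonal entry is the only one in
          column \<open>z\<close>.\<close>
        define \<psi>' where "\<psi>' = (\<chi> j. if j = z then \<bar>s\<bar> + 1 else \<psi> $ j)"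
        show "0 < \<psi>' $ i" for i
          using pos by (simp add: \<psi>'_def add_nonneg_pos)
        show "0 < (U *v \<psi>') $ i" for i
        proof -
          have "(U *v \<psi>') $ i = U $ i $ z * \<psi>' $ z + (\<Sum>j\<in>UNIV - {z}. U $ i $ j * \<psi>' $ j)"
            unfolding matrix_vector_nth by (simp add: sum.remove)
          also have "(\<Sum>j\<in>UNIV - {z}. U $ i $ j * \<psi>' $ j) = (\<Sum>j\<in>UNIV - {z}. M Z $ i $ j * \<psi> $ j)"
            by (intro sum.cong) (auto simp: U_def \<psi>'_def replace_column_def)
          finally have split: "(U *v \<psi>') $ i =
              axis z 1 $ i * (\<bar>s\<bar> + 1) + (\<Sum>j\<in>UNIV - {z}. M Z $ i $ j * \<psi> $ j)"
            by (simp add: U_def \<psi>'_def replace_column_def)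
          show ?thesis
          proof (cases "i = z")
            case True
            then show ?thesis
              using split by (simp add: axis_def s_def[symmetric])
          next
            case iz: False
            have "0 < ((B - diag_matrix d) *v \<psi>) $ i"
              by (rule Bpos)
            also have "\<dots> \<le> (M Z *v \<psi>) $ i"
              unfolding matrix_vector_nth
              using pos d by (intro sum_mono mult_right_mono) (auto simp: M_def diag_matrix_def less_imp_le)
            also have "\<dots> = M Z $ i $ z * \<psi> $ z + (\<Sum>j\<in>UNIV - {z}. M Z $ i $ j * \<psi> $ j)"
              unfolding matrix_vector_nth by (simp add: sum.remove)
            also have "\<dots> \<le> (\<Sum>j\<in>UNIV - {z}. M Z $ i $ j * \<psi> $ j)"
              using offdiag[OF iz] pos[of z] by (simp add: mult_nonpos_nonneg)
            finally show ?thesis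
              using split iz by (simp add: axis_def)
          qed
        qed
      qed (rule c)
      then have "0 \<le> det (replace_column N z (axis z 1))"
        by (simp add: swap)
      then have "det (replace_column (M (insert z Z)) k c) \<le> det N"
        unfolding new det_column_linear old using d[of z] by simp
      then show ?thesis
        using insert.IH by (simp add: N_def)
    qed
  qed
  moreover have "M UNIV = B - diag_matrix d"
    by (simp add: M_def diag_matrix_def vec_eq_iff)
  ultimately show ?thesis
    using finite_class.finite_UNIV by metis
qed

section \<open>Spectral theory of reversible matrices\<close>

text \<open>
  A minimiser of the Rayleigh quotient on the unit sphere of \<open>V\<close> is an eigenvector of the compression
  of \<open>g\<close> to \<open>V\<close>. The subspace need not be invariant under \<open>g\<close>: invariant subspaces give the eigenbasis,
  coordinate subspaces the first eigenvalues of minors.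
\<close>

lemma rayleigh_minimizer:
  fixes g :: "'b::euclidean_space \<Rightarrow> 'b"
  assumes lin: "linear g" and sym: "\<And>x y. g x \<bullet> y = x \<bullet> g y"
    and V: "subspace V" "V \<noteq> {0}"
  obtains v \<mu> where "v \<in> V" and "v \<noteq> 0"
    and "\<And>w. w \<in> V \<Longrightarrow> \<mu> * (w \<bullet> w) \<le> g w \<bullet> w"
    and "\<And>w. w \<in> V \<Longrightarrow> g v \<bullet> w = \<mu> * (v \<bullet> w)"
proof -
  interpret linear g by (rule lin)
  define C where "C = V \<inter> sphere 0 1"
  have unit: "(1 / norm w) *\<^sub>R w \<in> C" if "w \<in> V" "w \<noteq> 0" for w
    using that V(1) by (simp add: C_def subspace_scale)
  have "compact C"
    using V(1) by (simp add: C_def closed_subspace compact_Int_closed inf_commute closed_Int_compact)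
  moreover obtain w0 where "w0 \<in> V" "w0 \<noteq> 0"
    using V subspace_0 by blast
  then have "C \<noteq> {}"
    using unit by blast
  moreover have "continuous_on C (\<lambda>w. g w \<bullet> w)"
    by (intro continuous_intros linear_continuous_on linear_conv_bounded_linear[THEN iffD1] lin)
  ultimately obtain v where v: "v \<in> C" and min: "\<And>w. w \<in> C \<Longrightarrow> g v \<bullet> v \<le> g w \<bullet> w"
    using continuous_attains_inf[of C "\<lambda>w. g w \<bullet> w"] by blast
  define \<mu> where "\<mu> = g v \<bullet> v"
  have vV: "v \<in> V" and vv: "v \<bullet> v = 1"
    using v by (auto simp: C_def dot_square_norm)
  have low: "\<mu> * (w \<bullet> w) \<le> g w \<bullet> w" if "w \<in> V" for w
  proof (cases "w = 0")
    case False
    have "\<mu> \<le> (g w \<bullet> w) / (norm w)\<^sup>2"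
      using min[OF unit[OF that False]] by (simp add: \<mu>_def scaleR power2_eq_square)
    then show ?thesis
      using False by (simp add: pos_le_divide_eq dot_square_norm)
  qed simp
  have "g v \<bullet> w = \<mu> * (v \<bullet> w)" if "w \<in> V" for w
  proof (rule ccontr)
    \<comment> \<open>Otherwise moving from \<open>v\<close> a little in the direction \<open>\<plusminus>w\<close> would lower the quotient.\<close>
    assume neq: "g v \<bullet> w \<noteq> \<mu> * (v \<bullet> w)"
    define b where "b = g v \<bullet> w - \<mu> * (v \<bullet> w)"
    define q where "q = g w \<bullet> w - \<mu> * (w \<bullet> w)"
    have "0 \<le> 2 * t * b + t\<^sup>2 * q" for t
    proof -
      have "v + t *\<^sub>R w \<in> V"
        using V(1) vV that by (simp add: subspace_add subspace_scale)
      then have "0 \<le> g (v + t *\<^sub>R w) \<bullet> (v + t *\<^sub>R w) - \<mu> * ((v + t *\<^sub>R w) \<bullet> (v + t *\<^sub>R w))"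
        using low by simp
      also have "g (v + t *\<^sub>R w) \<bullet> (v + t *\<^sub>R w) = \<mu> + 2 * t * (g v \<bullet> w) + t\<^sup>2 * (g w \<bullet> w)"
        using sym[of w v]
        by (simp add: add scaleR inner_add_left inner_add_right inner_commute[of w "g v"]
            \<mu>_def power2_eq_square algebra_simps)
      also have "(v + t *\<^sub>R w) \<bullet> (v + t *\<^sub>R w) = 1 + 2 * t * (v \<bullet> w) + t\<^sup>2 * (w \<bullet> w)"
        by (simp add: inner_add_left inner_add_right inner_commute[of w v] vv
            power2_eq_square algebra_simps)
      finally show ?thesis
        by (simp add: b_def q_def algebra_simps)
    qed
    \<comment> \<open>This step has the right sign and makes the linear term dominate the quadratic one.\<close>
    from this[of "- b / (\<bar>q\<bar> + 1)"]
    have "2 * b\<^sup>2 / (\<bar>q\<bar> + 1) \<le> b\<^sup>2 / (\<bar>q\<bar> + 1)\<^sup>2 * q"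
      by (simp add: power2_eq_square)
    also have "\<dots> \<le> b\<^sup>2 / (\<bar>q\<bar> + 1)\<^sup>2 * (\<bar>q\<bar> + 1)"
      by (intro mult_left_mono) auto
    also have "\<dots> = b\<^sup>2 / (\<bar>q\<bar> + 1)"
      by (simp add: power2_eq_square add_nonneg_pos less_imp_neq[symmetric])
    finally have "b\<^sup>2 / (\<bar>q\<bar> + 1) \<le> 0"
      by simp
    moreover have "0 < \<bar>q\<bar> + 1"
      by simp
    ultimately have "b = 0"
      by (simp add: divide_le_0_iff)
    then show False
      using neq by (simp add: b_def)
  qed
  moreover have "v \<noteq> 0"
    using vv by auto
  ultimately show thesis
    using that vV low by blast
qed

text \<open>
  The orthogonal complement of an eigenvector in \<open>V\<close> is again invariant, so eigenvectors can be split
  off one at a time.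
\<close>

lemma orthogonal_eigenbasis:
  fixes g :: "'b::euclidean_space \<Rightarrow> 'b"
  assumes lin: "linear g" and sym: "\<And>x y. g x \<bullet> y = x \<bullet> g y"
    and "subspace V" and "g ` V \<subseteq> V"
  shows "\<exists>B \<subseteq> V. finite B \<and> card B = dim V \<and> 0 \<notin> B \<and> pairwise orthogonal B \<and>
    (\<forall>v\<in>B. \<exists>\<mu>. g v = \<mu> *\<^sub>R v)"
  using assms(3,4)
proof (induction "dim V" arbitrary: V)
  case 0
  then show ?case
    by (intro exI[of _ "{}"]) auto
next
  case (Suc n)
  have "V \<noteq> {0}"
    using Suc.hyps(2) by auto
  then obtain v \<mu> where v: "v \<in> V" "v \<noteq> 0"
    and stat: "\<And>w. w \<in> V \<Longrightarrow> g v \<bullet> w = \<mu> * (v \<bullet> w)"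
    using rayleigh_minimizer[OF lin sym Suc.prems(1)] by metis
  have "g v - \<mu> *\<^sub>R v \<in> V"
    using v(1) Suc.prems by (simp add: image_subset_iff subspace_diff subspace_scale)
  then have "(g v - \<mu> *\<^sub>R v) \<bullet> (g v - \<mu> *\<^sub>R v) = 0"
    using stat[of "g v - \<mu> *\<^sub>R v"] by (simp add: inner_diff_left)
  then have eig: "g v = \<mu> *\<^sub>R v"
    by simp
  define W where "W = {y \<in> V. orthogonal v y}"
  have "W = {y \<in> V. \<forall>x\<in>span {v}. orthogonal x y}"
    by (auto simp: W_def span_singleton orthogonal_def)
  moreover have "dim (span {v}) = 1"
    using v(2) by simp
  ultimately have "dim W + 1 = dim V"
    using dim_subspace_orthogonal_to_vectors[of "span {v}" V] v(1) Suc.prems(1)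
    by (simp add: span_minimal)
  then have dW: "n = dim W"
    using Suc.hyps(2) by simp
  have "subspace W"
    using Suc.prems(1)
    by (auto simp: W_def subspace_def orthogonal_def inner_simps)
  moreover have "g ` W \<subseteq> W"
  proof
    fix y assume "y \<in> g ` W"
    then obtain w where w: "w \<in> V" "v \<bullet> w = 0" "y = g w"
      by (auto simp: W_def orthogonal_def)
    then show "y \<in> W"
      using Suc.prems(2) sym[of v w] by (auto simp: W_def orthogonal_def eig)
  qed
  ultimately obtain B where B: "B \<subseteq> W" "finite B" "card B = dim W" "0 \<notin> B"
      "pairwise orthogonal B" "\<forall>v\<in>B. \<exists>\<mu>. g v = \<mu> *\<^sub>R v"
    using Suc.hyps(1)[OF dW] by blast
  have "v \<notin> B"
    using B(1) v(2) by (auto simp: W_def orthogonal_def)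
  moreover have "pairwise orthogonal (insert v B)"
    using B(1,5) by (auto simp: pairwise_insert W_def orthogonal_commute)
  moreover have "insert v B \<subseteq> V"
    using B(1) v(1) by (auto simp: W_def)
  moreover have "card (insert v B) = dim V"
    using B(2,3) \<open>v \<notin> B\<close> dW Suc.hyps(2) by simp
  moreover have "\<forall>u\<in>insert v B. \<exists>\<mu>. g u = \<mu> *\<^sub>R u"
    using B(6) eig by blast
  moreover have "finite (insert v B)" "0 \<notin> insert v B"
    using B(2,4) v(2) by simp_all
  ultimately show ?case
    by (intro exI[of _ "insert v B"] conjI)
qed

text \<open>
  Conjugation by the diagonal matrix of the \<open>sqrt (\<eta> i)\<close>. It turns self-adjointness in the inner
  product weighted by \<open>\<eta>\<close> into symmetry.
\<close>

definition symmetrization :: "('n \<Rightarrow> real) \<Rightarrow> real ^ 'n ^ 'n \<Rightarrow> real ^ 'n ^ 'n" where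
  "symmetrization \<eta> A = (\<chi> i j. sqrt (\<eta> i) * A $ i $ j / sqrt (\<eta> j))"

locale reversible_matrix =
  fixes A :: "real ^ 'n ^ 'n" and \<eta> :: "'n \<Rightarrow> real"
  assumes eta_pos: "\<And>i. 0 < \<eta> i"
    and balance: "\<And>i j. \<eta> i * A $ i $ j = \<eta> j * A $ j $ i"
begin

lemma self_adjoint: "(\<Sum>i\<in>UNIV. \<eta> i * f $ i * (A *v g) $ i) = (\<Sum>i\<in>UNIV. \<eta> i * (A *v f) $ i * g $ i)"
proof -
  have "(\<Sum>i\<in>UNIV. \<eta> i * f $ i * (A *v g) $ i) =
      (\<Sum>i\<in>UNIV. \<Sum>j\<in>UNIV. f $ i * g $ j * (\<eta> i * A $ i $ j))"
    by (simp add: matrix_vector_nth sum_distrib_left mult_ac)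
  also have "\<dots> = (\<Sum>j\<in>UNIV. \<Sum>i\<in>UNIV. f $ i * g $ j * (\<eta> i * A $ i $ j))"
    by (rule sum.swap)
  also have "\<dots> = (\<Sum>j\<in>UNIV. \<Sum>i\<in>UNIV. f $ i * g $ j * (\<eta> j * A $ j $ i))"
    by (intro sum.cong refl arg_cong[where f="(*) _"] balance)
  also have "\<dots> = (\<Sum>i\<in>UNIV. \<eta> i * (A *v f) $ i * g $ i)"
    by (simp add: matrix_vector_nth sum_distrib_left sum_distrib_right mult_ac)
  finally show ?thesis .
qed

lemma symmetrization_symmetric: "(symmetrization \<eta> A *v x) \<bullet> y = x \<bullet> (symmetrization \<eta> A *v y)"
proof -
  have "symmetrization \<eta> A $ i $ j = symmetrization \<eta> A $ j $ i" for i j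
  proof -
    have "sqrt (\<eta> i) * A $ i $ j * sqrt (\<eta> i) = sqrt (\<eta> i) * sqrt (\<eta> i) * A $ i $ j"
      by simp
    also have "\<dots> = sqrt (\<eta> j) * sqrt (\<eta> j) * A $ j $ i"
      using balance[of i j] eta_pos by (simp only: real_sqrt_mult_self abs_of_pos)
    also have "\<dots> = sqrt (\<eta> j) * A $ j $ i * sqrt (\<eta> j)"
      by simp
    finally show ?thesis
      unfolding symmetrization_def vec_lambda_beta
      using eta_pos[of i] eta_pos[of j] by (intro frac_eq_eq[THEN iffD2]) auto
  qed
  then have "transpose (symmetrization \<eta> A) = symmetrization \<eta> A"
    by (simp add: transpose_def vec_eq_iff)
  then show ?thesis
    by (metis dot_lmul_matrix transpose_matrix_vector)
qed

lemma symmetrization_apply: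
  "(symmetrization \<eta> A *v v) $ i = sqrt (\<eta> i) * (A *v (\<chi> j. v $ j / sqrt (\<eta> j))) $ i"
  by (simp add: matrix_vector_nth symmetrization_def sum_distrib_left mult_ac)

lemma diagonalization:
  obtains d :: "'n \<Rightarrow> real" where "\<And>t. det (A - mat t) = (\<Prod>i\<in>UNIV. d i - t)"
proof -
  let ?S = "symmetrization \<eta> A"
  obtain B where B: "finite B" "card B = CARD('n)" "0 \<notin> B" "pairwise orthogonal B"
    and eig: "\<forall>v\<in>B. \<exists>\<mu>. ?S *v v = \<mu> *\<^sub>R v"
    using orthogonal_eigenbasis[of "(*v) ?S" UNIV] symmetrization_symmetric by auto
  obtain h where h: "bij_betw h (UNIV :: 'n set) B"
    using finite_same_card_bij[of "UNIV :: 'n set" B] B(1,2) by auto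
  then have hB: "h j \<in> B" for j
    by (auto dest: bij_betwE)
  then have "\<forall>j. \<exists>\<mu>. ?S *v h j = \<mu> *\<^sub>R h j"
    using eig by blast
  then obtain d where d: "\<And>j. ?S *v h j = d j *\<^sub>R h j"
    by metis
  \<comment> \<open>Undoing the symmetrization turns its eigenvectors \<open>h j\<close> into eigenvectors of \<open>A\<close>.\<close>
  define Q where "Q = (\<chi> i j. h j $ i / sqrt (\<eta> i))"
  have QD: "(A - mat t) ** Q = Q ** (\<chi> i j. if i = j then d i - t else 0)" for t
  proof -
    have "(\<Sum>k\<in>UNIV. (A $ i $ k - (if i = k then t else 0)) * Q $ k $ j) = Q $ i $ j * (d j - t)" for i j
    proof -
      have "sqrt (\<eta> i) * (\<Sum>k\<in>UNIV. A $ i $ k * Q $ k $ j) = d j * h j $ i"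
        using symmetrization_apply[of "h j" i] d[of j] by (simp add: matrix_vector_nth Q_def)
      then have "(\<Sum>k\<in>UNIV. A $ i $ k * Q $ k $ j) = d j * Q $ i $ j"
        using eta_pos[of i] by (simp add: Q_def field_simps)
      then show ?thesis
        by (simp add: left_diff_distrib sum_subtractf if_distrib[of "\<lambda>x. x * _"] cong: if_cong)
           (simp add: algebra_simps)
    qed
    then show ?thesis
      by (simp add: matrix_matrix_mult_def vec_eq_iff mat_def if_distrib[of "\<lambda>x. _ * x"] cong: if_cong)
  qed
  have "x = 0" if "Q *v x = 0" for x
  proof -
    have "(\<Sum>j\<in>UNIV. x $ j *\<^sub>R h j) $ i = sqrt (\<eta> i) * (Q *v x) $ i" for i
      using eta_pos[of i] by (simp add: matrix_vector_nth Q_def sum_distrib_left mult_ac)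
    then have zero: "(\<Sum>j\<in>UNIV. x $ j *\<^sub>R h j) = 0"
      using that by (simp add: vec_eq_iff)
    have "x $ i = 0" for i
    proof -
      have orth: "h j \<bullet> h i = 0" if "j \<noteq> i" for j
      proof -
        have "h j \<noteq> h i"
          using h that by (auto simp: bij_betw_def dest: injD)
        then show ?thesis
          using B(4) hB by (simp add: pairwise_def orthogonal_def)
      qed
      have "0 = (\<Sum>j\<in>UNIV. x $ j *\<^sub>R h j) \<bullet> h i"
        using zero by simp
      also have "\<dots> = (\<Sum>j\<in>UNIV. if j = i then x $ i * (h i \<bullet> h i) else 0)"
        unfolding inner_sum_left by (intro sum.cong) (auto simp: orth)
      also have "\<dots> = x $ i * (h i \<bullet> h i)"
        by simp
      finally show ?thesis
        using hB[of i] B(3) by auto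
    qed
    then show ?thesis
      by (simp add: vec_eq_iff)
  qed
  then have nz: "det Q \<noteq> 0"
    by (simp add: invertible_det_nz[symmetric] invertible_left_inverse matrix_left_invertible_ker)
  have "det (A - mat t) * det Q = det Q * (\<Prod>i\<in>UNIV. d i - t)" for t
    using arg_cong[OF QD[of t], of det] by (simp add: det_mul det_diagonal)
  then have "det (A - mat t) = (\<Prod>i\<in>UNIV. d i - t)" for t
    using nz by (metis mult.commute mult_right_cancel)
  then show thesis
    by (rule that)
qed

text \<open>
  Eigenfunctions of a minor for distinct eigenvalues are orthogonal in the weighted inner product,
  and an orthogonal family of nonzero vectors is finite.
\<close>

lemma finite_minor_eigenvalues: "finite {\<mu>. minor_eigenvalue A T \<mu>}"
proof -
  let ?E = "{\<mu>. minor_eigenvalue A T \<mu>}"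
  have "\<forall>\<mu>\<in>?E. \<exists>f. (\<exists>x\<in>T. f x \<noteq> 0) \<and> (\<forall>x\<in>T. (\<Sum>y\<in>T. A $ x $ y * f y) = \<mu> * f x)"
    by (simp add: minor_eigenvalue_def)
  then obtain f where f: "\<forall>\<mu>\<in>?E. (\<exists>x\<in>T. f \<mu> x \<noteq> 0) \<and> (\<forall>x\<in>T. (\<Sum>y\<in>T. A $ x $ y * f \<mu> y) = \<mu> * f \<mu> x)"
    by metis
  define v where "v \<mu> = (\<chi> i. if i \<in> T then sqrt (\<eta> i) * f \<mu> i else 0)" for \<mu>
  have inner: "v \<mu> \<bullet> v \<nu> = (\<Sum>i\<in>T. \<eta> i * f \<mu> i * f \<nu> i)" for \<mu> \<nu>
  proof -
    have "v \<mu> \<bullet> v \<nu> = (\<Sum>i\<in>UNIV. if i \<in> T then \<eta> i * f \<mu> i * f \<nu> i else 0)"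
      using eta_pos by (auto simp: inner_vec_def v_def less_imp_le intro!: sum.cong)
    then show ?thesis
      by (simp add: sum.If_cases)
  qed
  have orth: "v \<mu> \<bullet> v \<nu> = 0" if "\<mu> \<in> ?E" "\<nu> \<in> ?E" "\<mu> \<noteq> \<nu>" for \<mu> \<nu>
  proof -
    have "\<mu> * (v \<mu> \<bullet> v \<nu>) = (\<Sum>i\<in>T. \<eta> i * f \<nu> i * (\<mu> * f \<mu> i))"
      by (simp add: inner sum_distrib_left mult_ac)
    also have "\<dots> = (\<Sum>i\<in>T. \<eta> i * f \<nu> i * (\<Sum>j\<in>T. A $ i $ j * f \<mu> j))"
      using f that(1) by (intro sum.cong) auto
    also have "\<dots> = (\<Sum>i\<in>T. \<Sum>j\<in>T. f \<nu> i * f \<mu> j * (\<eta> i * A $ i $ j))"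
      by (simp add: sum_distrib_left mult_ac)
    also have "\<dots> = (\<Sum>j\<in>T. \<Sum>i\<in>T. f \<nu> i * f \<mu> j * (\<eta> i * A $ i $ j))"
      by (rule sum.swap)
    also have "\<dots> = (\<Sum>j\<in>T. \<Sum>i\<in>T. f \<nu> i * f \<mu> j * (\<eta> j * A $ j $ i))"
      by (intro sum.cong refl arg_cong[where f="(*) _"] balance)
    also have "\<dots> = (\<Sum>j\<in>T. \<eta> j * f \<mu> j * (\<Sum>i\<in>T. A $ j $ i * f \<nu> i))"
      by (simp add: sum_distrib_left mult_ac)
    also have "\<dots> = (\<Sum>j\<in>T. \<eta> j * f \<mu> j * (\<nu> * f \<nu> j))"
      using f that(2) by (intro sum.cong) auto
    also have "\<dots> = \<nu> * (v \<mu> \<bullet> v \<nu>)"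
      by (simp add: inner sum_distrib_left mult_ac)
    finally show ?thesis
      using that(3) by simp
  qed
  have nz: "v \<mu> \<noteq> 0" if \<mu>: "\<mu> \<in> ?E" for \<mu>
  proof -
    obtain x where "x \<in> T" "f \<mu> x \<noteq> 0"
      using bspec[OF f \<mu>] by auto
    then have "v \<mu> $ x \<noteq> 0"
      using eta_pos[of x] by (simp add: v_def)
    then show ?thesis
      by auto
  qed
  have "inj_on v ?E"
  proof (rule inj_onI)
    fix \<mu> \<nu> assume *: "\<mu> \<in> ?E" "\<nu> \<in> ?E" "v \<mu> = v \<nu>"
    show "\<mu> = \<nu>"
    proof (rule ccontr)
      assume "\<mu> \<noteq> \<nu>"
      then have "v \<mu> \<bullet> v \<mu> = 0"
        using orth[OF *(1,2)] *(3) by simp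
      then show False
        using nz[OF *(1)] by simp
    qed
  qed
  moreover have "independent (v ` ?E)"
  proof (rule pairwise_orthogonal_independent)
    show "pairwise orthogonal (v ` ?E)"
      unfolding pairwise_image by (auto simp: pairwise_def orthogonal_def intro!: orth)
    show "0 \<notin> v ` ?E"
      using nz by force
  qed
  then have "finite (v ` ?E)"
    using independent_bound by blast
  ultimately show ?thesis
    using finite_imageD by blast
qed

text \<open>
  The minimum of the Rayleigh quotient over the vectors supported in \<open>T\<close> is itself an eigenvalue of
  the minor, so it is at least the least one.
\<close>

lemma least_minor_eigenvalue_le_rayleigh:
  fixes f :: "real ^ 'n"
  assumes "T \<noteq> {}" and supp: "\<And>i. i \<notin> T \<Longrightarrow> f $ i = 0"
  shows "Min {\<mu>. minor_eigenvalue A T \<mu>} * (\<Sum>i\<in>UNIV. \<eta> i * (f $ i)\<^sup>2) \<le>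
    (\<Sum>i\<in>UNIV. \<eta> i * f $ i * (A *v f) $ i)"
    and "minor_eigenvalue A T (Min {\<mu>. minor_eigenvalue A T \<mu>})"
proof -
  let ?S = "symmetrization \<eta> A"
  define V where "V = {v :: real ^ 'n. \<forall>i. i \<notin> T \<longrightarrow> v $ i = 0}"
  have sub: "subspace V"
    by (auto simp: V_def subspace_def)
  have axis_V: "axis i 1 \<in> V" if "i \<in> T" for i
    using that by (auto simp: V_def axis_def)
  then have "V \<noteq> {0}"
    using assms(1) by (metis axis_eq_0_iff all_not_in_conv singletonD zero_neq_one)
  then obtain v \<mu> where v: "v \<in> V" "v \<noteq> 0"
    and low: "\<And>w. w \<in> V \<Longrightarrow> \<mu> * (w \<bullet> w) \<le> (?S *v w) \<bullet> w"
    and stat: "\<And>w. w \<in> V \<Longrightarrow> (?S *v v) \<bullet> w = \<mu> * (v \<bullet> w)"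
    using rayleigh_minimizer[of "(*v) ?S" V] symmetrization_symmetric sub by auto
  define u where "u i = v $ i / sqrt (\<eta> i)" for i
  have "(\<Sum>y\<in>T. A $ x $ y * u y) = \<mu> * u x" if x: "x \<in> T" for x
  proof -
    have "(\<Sum>y\<in>T. A $ x $ y * u y) = (A *v (\<chi> j. u j)) $ x"
      unfolding matrix_vector_nth
      using v(1) by (intro sum.mono_neutral_cong_left) (auto simp: u_def V_def)
    moreover have "sqrt (\<eta> x) * (A *v (\<chi> j. u j)) $ x = \<mu> * v $ x"
      using stat[OF axis_V[OF x]] symmetrization_apply[of v x] by (simp add: inner_axis u_def)
    ultimately show ?thesis
      using eta_pos[of x] by (simp add: u_def field_simps)
  qed
  moreover obtain x where "v $ x \<noteq> 0"
    using v(2) by (auto simp: vec_eq_iff)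
  then have "x \<in> T" "u x \<noteq> 0"
    using v(1) eta_pos[of x] by (auto simp: V_def u_def)
  ultimately have mu: "minor_eigenvalue A T \<mu>"
    unfolding minor_eigenvalue_def by blast
  then show "minor_eigenvalue A T (Min {\<mu>. minor_eigenvalue A T \<mu>})"
    using Min_in[OF finite_minor_eigenvalues, of T] by auto
  have le: "Min {\<mu>. minor_eigenvalue A T \<mu>} \<le> \<mu>"
    using mu finite_minor_eigenvalues by (intro Min_le) auto
  define w where "w = (\<chi> i. sqrt (\<eta> i) * f $ i)"
  have "w \<in> V"
    using supp by (simp add: V_def w_def)
  moreover have wf: "(\<chi> j. w $ j / sqrt (\<eta> j)) = f"
    using eta_pos by (simp add: w_def vec_eq_iff less_imp_neq[symmetric])
  have "w \<bullet> w = (\<Sum>i\<in>UNIV. \<eta> i * (f $ i)\<^sup>2)"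
    using eta_pos by (auto simp: inner_vec_def w_def power2_eq_square less_imp_le intro!: sum.cong)
  moreover have "(?S *v w) \<bullet> w = (\<Sum>i\<in>UNIV. \<eta> i * f $ i * (A *v f) $ i)"
    unfolding inner_vec_def symmetrization_apply wf
    using eta_pos by (auto simp: w_def less_imp_le intro!: sum.cong)
  ultimately have "\<mu> * (\<Sum>i\<in>UNIV. \<eta> i * (f $ i)\<^sup>2) \<le> (\<Sum>i\<in>UNIV. \<eta> i * f $ i * (A *v f) $ i)"
    using low by metis
  moreover have "Min {\<mu>. minor_eigenvalue A T \<mu>} * (\<Sum>i\<in>UNIV. \<eta> i * (f $ i)\<^sup>2) \<le>
      \<mu> * (\<Sum>i\<in>UNIV. \<eta> i * (f $ i)\<^sup>2)"
    using le eta_pos by (intro mult_right_mono sum_nonneg) (auto simp: less_imp_le)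
  ultimately show "Min {\<mu>. minor_eigenvalue A T \<mu>} * (\<Sum>i\<in>UNIV. \<eta> i * (f $ i)\<^sup>2) \<le>
    (\<Sum>i\<in>UNIV. \<eta> i * f $ i * (A *v f) $ i)"
    by (rule order_trans[rotated])
qed

end

lemma poly_charpoly: "poly (charpoly A) t = det (mat t - A)"
  unfolding charpoly_def det_def
  by (simp add: poly_sum poly_prod mat_def if_distrib[of "\<lambda>p. poly p t"] cong: if_cong)

lemma sorted_eigenvalues_eqI:
  fixes A :: "real ^ 'n ^ 'n" and d :: "'n \<Rightarrow> real"
  assumes "\<And>t. det (A - mat t) = (\<Prod>i\<in>UNIV. d i - t)"
  shows "sorted_eigenvalues A = sorted_list_of_multiset (image_mset d (mset_set UNIV))"
proof -
  have "det (mat t - A) = (\<Prod>i\<in>UNIV. t - d i)" for t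
  proof -
    have "mat t - A = (\<chi> i. (- 1) *s (A - mat t) $ i)"
      by (simp add: vec_eq_iff)
    then have "det (mat t - A) = (\<Prod>i\<in>(UNIV::'n set). - 1) * det (A - mat t)"
      by (simp only: det_rows_mul vec_lambda_eta)
    then have "det (mat t - A) = (\<Prod>i\<in>UNIV. (- 1) * (d i - t))"
      unfolding assms prod.distrib .
    then show ?thesis
      by simp
  qed
  then have "charpoly A = (\<Prod>i\<in>UNIV. [:- d i, 1:])"
    by (subst poly_eq_poly_eq_iff[symmetric]) (auto simp: poly_charpoly poly_prod fun_eq_iff)
  then have "proots (charpoly A) = (\<Sum>i\<in>UNIV. {#d i#})"
    by (simp add: proots_prod)
  also have "\<dots> = image_mset d (mset_set UNIV)"
    by (simp add: sum_unfold_sum_mset)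
  finally show ?thesis
    by (simp add: sorted_eigenvalues_def)
qed

section \<open>Maximum principles for an irreducible matrix\<close>

locale positive_eigenpair =
  fixes A :: "real ^ 'n ^ 'n" and \<phi> :: "real ^ 'n" and lam :: real
  assumes z_matrix: "z_matrix A"
    and connected: "\<And>x y. (x, y) \<in> {(u, v). u \<noteq> v \<and> A $ u $ v < 0}\<^sup>*"
    and phi_pos: "\<And>i. 0 < \<phi> $ i"
    and eigenvector: "A *v \<phi> = lam *\<^sub>R \<phi>"
begin

text \<open>
  Strong maximum principle. Take the least multiple of \<open>\<phi>\<close> above \<open>u\<close>. The difference \<open>g\<close> is
  nonnegative, satisfies \<open>lam * g \<le> A g\<close> and has a zero; at a zero this inequality forces all
  neighbours to be zeros too, and irreducibility spreads them everywhere.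
\<close>

lemma subsolution_proportional:
  assumes sub: "\<And>i. (A *v u) $ i \<le> lam * u $ i"
  obtains M where "u = M *\<^sub>R \<phi>"
proof -
  obtain k m where k: "(- u) $ k = m * \<phi> $ k" and le: "\<And>j. m * \<phi> $ j \<le> (- u) $ j"
    using minimal_ratio[OF phi_pos] by blast
  define g where "g = (- m) *\<^sub>R \<phi> - u"
  have g_nonneg: "0 \<le> g $ i" for i
    using le[of i] by (simp add: g_def)
  have "A *v g = (- m) *\<^sub>R (lam *\<^sub>R \<phi>) - A *v u"
    unfolding g_def matrix_vector_mult_diff_distrib matrix_vector_mult_scaleR eigenvector ..
  then have super: "lam * g $ i \<le> (A *v g) $ i" for i
    using sub[of i] by (simp add: g_def algebra_simps)
  have step: "g $ v = 0" if "g $ u = 0" "u \<noteq> v" "A $ u $ v < 0" for u v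
  proof -
    have terms: "0 \<le> - (A $ u $ j * g $ j)" for j
      using z_matrix g_nonneg[of j] that(1)
      by (cases "j = u") (auto simp: z_matrix_def mult_nonpos_nonneg)
    have "(\<Sum>j\<in>UNIV. - (A $ u $ j * g $ j)) \<le> 0"
      using super[of u] that(1) by (simp add: matrix_vector_nth sum_negf)
    then have "(\<Sum>j\<in>UNIV. - (A $ u $ j * g $ j)) = 0"
      using terms by (meson order_antisym sum_nonneg)
    then have "- (A $ u $ v * g $ v) = 0"
      using terms sum_nonneg_eq_0_iff[of UNIV "\<lambda>j. - (A $ u $ j * g $ j)"] by simp
    then show ?thesis
      using that(3) by simp
  qed
  have "g $ i = 0" for i
    using connected[of k i]
  proof (induction rule: rtrancl_induct)
    case base
    then show ?case
      using k by (simp add: g_def)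
  next
    case (step u v)
    then show ?case
      using \<open>\<And>u v. g $ u = 0 \<Longrightarrow> u \<noteq> v \<Longrightarrow> A $ u $ v < 0 \<Longrightarrow> g $ v = 0\<close> by blast
  qed
  then have "u = (- m) *\<^sub>R \<phi>"
    by (simp add: g_def vec_eq_iff algebra_simps)
  then show thesis
    by (rule that)
qed

text \<open>
  For an eigenfunction \<open>f\<close> of the minor, \<open>\<bar>f\<bar>\<close> extended by zero satisfies \<open>A \<bar>f\<bar> \<le> \<mu> * \<bar>f\<bar>\<close> on \<open>T\<close>, because
  the off-diagonal entries are nonpositive, and \<open>A \<bar>f\<bar> \<le> 0\<close> off \<open>T\<close>. If \<open>\<mu> \<le> lam\<close>, it is a subsolution,
  hence a positive multiple of \<open>\<phi>\<close>: this cannot vanish off \<open>T\<close>, and it excludes \<open>\<mu> < lam\<close>.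
\<close>

lemma minor_eigenvalue_lower_bound:
  assumes "minor_eigenvalue A T \<mu>"
  shows "lam \<le> \<mu>" and "T \<noteq> UNIV \<Longrightarrow> lam < \<mu>"
proof -
  obtain f x where x: "x \<in> T" "f x \<noteq> 0"
    and f: "\<And>i. i \<in> T \<Longrightarrow> (\<Sum>j\<in>T. A $ i $ j * f j) = \<mu> * f i"
    using assms unfolding minor_eigenvalue_def by blast
  define F where "F = (\<chi> i. if i \<in> T then f i else 0)"
  define u where "u = (\<chi> i. \<bar>F $ i\<bar>)"
  have AF: "(A *v F) $ i = \<mu> * F $ i" if "i \<in> T" for i
  proof -
    have "(A *v F) $ i = (\<Sum>j\<in>T. A $ i $ j * f j)"
      unfolding matrix_vector_nth by (intro sum.mono_neutral_cong_right) (auto simp: F_def)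
    then show ?thesis
      using f[OF that] that by (simp add: F_def)
  qed
  have Au: "(A *v u) $ i \<le> (if i \<in> T then \<mu> * u $ i else 0)" for i
  proof (cases "F $ i = 0")
    case True
    then show ?thesis
      using z_matrix_row_touching[OF z_matrix, of u i] by (simp add: u_def)
  next
    case False
    then have iT: "i \<in> T"
      by (auto simp: F_def split: if_splits)
    have "A $ i $ j * u $ j \<le> sgn (F $ i) * (A $ i $ j * F $ j)" for j
    proof (cases "j = i")
      case True
      then show ?thesis
        by (simp add: u_def abs_sgn mult_ac)
    next
      case ne: False
      have "sgn (F $ i) * F $ j \<le> u $ j"
        by (auto simp: u_def sgn_if)
      moreover have "A $ i $ j \<le> 0"
        using z_matrix ne by (auto simp: z_matrix_def)
      ultimately have "A $ i $ j * u $ j \<le> A $ i $ j * (sgn (F $ i) * F $ j)"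
        by (rule mult_left_mono_neg)
      then show ?thesis
        by (simp add: mult_ac)
    qed
    then have "(A *v u) $ i \<le> sgn (F $ i) * (A *v F) $ i"
      unfolding matrix_vector_nth sum_distrib_left by (intro sum_mono)
    then show ?thesis
      using AF[OF iT] iT by (simp add: u_def abs_sgn mult_ac)
  qed
  have ux: "0 < u $ x"
    using x by (simp add: u_def F_def)
  have multiple: "\<exists>M>0. u = M *\<^sub>R \<phi>" if "\<mu> \<le> lam"
  proof -
    have "(A *v u) $ i \<le> lam * u $ i" for i
    proof -
      have "\<mu> * u $ i \<le> lam * u $ i"
        using that by (intro mult_right_mono) (auto simp: u_def)
      moreover have "u $ i = 0" if "i \<notin> T"
        using that by (simp add: u_def F_def)
      ultimately show ?thesis
        using Au[of i] by (auto split: if_splits)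
    qed
    then obtain M where M: "u = M *\<^sub>R \<phi>"
      using subsolution_proportional by blast
    then have "0 < M"
      using ux phi_pos[of x] by (simp add: zero_less_mult_iff)
    then show ?thesis
      using M by blast
  qed
  show "lam \<le> \<mu>"
  proof (rule ccontr)
    assume "\<not> lam \<le> \<mu>"
    then obtain M where "u = M *\<^sub>R \<phi>"
      using multiple by auto
    then have "(A *v u) $ x = lam * u $ x"
      by (simp add: matrix_vector_mult_scaleR eigenvector)
    then have "lam * u $ x \<le> \<mu> * u $ x"
      using Au[of x] x by simp
    then show False
      using ux \<open>\<not> lam \<le> \<mu>\<close> by simp
  qed
  show "lam < \<mu>" if T: "T \<noteq> UNIV"
  proof (rule ccontr)
    assume "\<not> lam < \<mu>"
    then obtain M where M: "0 < M" "u = M *\<^sub>R \<phi>"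
      using multiple by auto
    obtain z where "z \<notin> T"
      using T by blast
    then have "u $ z = 0"
      by (simp add: u_def F_def)
    then show False
      using M phi_pos[of z] by simp
  qed
qed

lemma shifted_image: "(A - mat t) *v f = A *v f - t *\<^sub>R f"
  by (simp add: matrix_vector_mult_diff_rdistrib vec_eq_iff)
     (simp add: matrix_vector_nth mat_def if_distrib[of "\<lambda>x. x * _"] cong: if_cong)

lemma root_imp_minor_eigenvalue:
  assumes "det (A - mat t) = 0"
  shows "minor_eigenvalue A UNIV t"
proof -
  have "\<not> invertible (A - mat t)"
    using assms by (simp add: invertible_det_nz)
  then obtain f where f: "(A - mat t) *v f = 0" "f \<noteq> 0"
    by (auto simp: invertible_left_inverse matrix_left_invertible_ker)
  then have "A *v f = t *\<^sub>R f"
    by (simp add: shifted_image)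
  then have "\<forall>i. (\<Sum>j\<in>UNIV. A $ i $ j * f $ j) = t * f $ i"
    by (simp add: matrix_vector_nth[symmetric])
  then show ?thesis
    using f(2) unfolding minor_eigenvalue_def by (auto simp: vec_eq_iff intro!: exI[of _ "\<lambda>i. f $ i"])
qed

text \<open>
  Both sides are the determinant of \<open>A - t\<close> with column \<open>z\<close> replaced by \<open>(A - t) \<phi> = (lam - t) \<phi>\<close>. It
  exhibits the factor \<open>lam - t\<close> of the characteristic polynomial together with its cofactor.
\<close>

lemma det_shifted_column:
  "\<phi> $ z * det (A - mat t) = (lam - t) * det (replace_column (A - mat t) z \<phi>)"
proof -
  have image: "(A - mat t) *v \<phi> = \<phi> - (1 - (lam - t)) *\<^sub>R \<phi>"
    unfolding shifted_image eigenvector by (simp add: algebra_simps)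
  have "\<phi> $ z * det (A - mat t) = det (replace_column (A - mat t) z (\<phi> - (1 - (lam - t)) *\<^sub>R \<phi>))"
    unfolding image[symmetric] det_replace_column_image ..
  also have "\<dots> = det (replace_column (A - mat t) z \<phi>) -
      (1 - (lam - t)) * det (replace_column (A - mat t) z \<phi>)"
    by (rule det_column_linear)
  finally show ?thesis
    by (simp add: algebra_simps)
qed

end

section \<open>Comparing the eigenvector with its mean\<close>

lemma continuous_on_shifted_cramer:
  "continuous_on UNIV (\<lambda>t. det (replace_column (A - mat t) k c))"
proof (rule continuous_on_det)
  show "continuous_on UNIV (\<lambda>t. replace_column (A - mat t) k c $ i $ j)" for i j
    by (cases "j = k"; cases "i = j")
       (auto simp: replace_column_def mat_def intro!: continuous_intros)
qed

lemma left_limit_le: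
  fixes f g :: "real \<Rightarrow> real"
  assumes "continuous_on UNIV f" and "continuous_on UNIV g" and "a < b"
    and "\<And>t. a \<le> t \<Longrightarrow> t < b \<Longrightarrow> f t \<le> g t"
  shows "f b \<le> g b"
proof (rule tendsto_le[of "at_left b" g "g b" f "f b"])
  show "(g \<longlongrightarrow> g b) (at_left b)" "(f \<longlongrightarrow> f b) (at_left b)"
    using assms(1,2) by (auto simp: continuous_on_def intro: tendsto_within_subset)
  show "\<forall>\<^sub>F t in at_left b. f t \<le> g t"
    using eventually_at_left_real[OF assms(3)] by eventually_elim (use assms(4) in auto)
qed simp

lemma left_limit_eq:
  fixes f g :: "real \<Rightarrow> real"
  assumes "continuous_on UNIV f" and "continuous_on UNIV g" and "a < b"
    and "\<And>t. a \<le> t \<Longrightarrow> t < b \<Longrightarrow> f t = g t"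
  shows "f b = g b"
  using left_limit_le[of f g a b] left_limit_le[of g f a b] assms by force

locale reversible_eigenpair = positive_eigenpair A \<phi> lam + reversible_matrix A \<eta>
  for A :: "real ^ 'n ^ 'n" and \<phi> lam \<eta>
begin

lemma eigenvector_pairing:
  "(\<Sum>i\<in>UNIV. \<eta> i * \<phi> $ i * (A *v f) $ i) = lam * (\<Sum>i\<in>UNIV. \<eta> i * \<phi> $ i * f $ i)"
  unfolding self_adjoint eigenvector by (simp add: sum_distrib_left mult_ac)

lemma eigenvector_norm_pos: "0 < (\<Sum>i\<in>UNIV. \<eta> i * (\<phi> $ i)\<^sup>2)"
  using eta_pos phi_pos by (intro sum_pos mult_pos_pos zero_less_power) auto

text \<open>
  The range of \<open>A - lam\<close> is orthogonal to \<open>\<phi>\<close> in the weighted inner product, so a kernel vector of the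
  matrix cannot involve the replaced column. What remains is a kernel vector of \<open>A - lam\<close>, thus a
  multiple of \<open>\<phi>\<close>, that vanishes at \<open>z\<close>.
\<close>

lemma det_eigenvector_column_nonzero: "det (replace_column (A - mat lam) z \<phi>) \<noteq> 0"
proof -
  let ?M = "replace_column (A - mat lam) z \<phi>"
  have "g = 0" if g: "?M *v g = 0" for g
  proof -
    define h where "h = g - (g $ z) *\<^sub>R axis z 1"
    have h: "h $ i = (if i = z then 0 else g $ i)" for i
      by (simp add: h_def axis_def)
    have dec: "?M *v g = (A - mat lam) *v h + (g $ z) *\<^sub>R \<phi>"
    proof -
      have "(?M *v g) $ i = ((A - mat lam) *v h) $ i + g $ z * \<phi> $ i" for i
        unfolding matrix_vector_nth
        by (simp add: sum.remove[of UNIV z] h replace_column_def mult.commute)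
      then show ?thesis
        by (simp add: vec_eq_iff)
    qed
    then have kernel: "A *v h - lam *\<^sub>R h + (g $ z) *\<^sub>R \<phi> = 0"
      using g by (simp add: shifted_image)
    then have "(\<Sum>i\<in>UNIV. \<eta> i * \<phi> $ i * (A *v h - lam *\<^sub>R h + (g $ z) *\<^sub>R \<phi>) $ i) = 0"
      by simp
    then have "g $ z * (\<Sum>i\<in>UNIV. \<eta> i * (\<phi> $ i)\<^sup>2) = 0"
      using eigenvector_pairing[of h]
      by (simp add: algebra_simps sum.distrib sum_subtractf sum_distrib_left power2_eq_square)
    then have gz: "g $ z = 0"
      using eigenvector_norm_pos by simp
    then have "(A *v h) $ i = lam * h $ i" for i
      using kernel by (simp add: vec_eq_iff)
    then obtain M where "h = M *\<^sub>R \<phi>"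
      using subsolution_proportional[of h] by auto
    moreover have "h $ z = 0"
      by (simp add: h)
    ultimately have "h = 0"
      using phi_pos[of z] by simp
    then show "g = 0"
      using gz by (simp add: h_def)
  qed
  then show ?thesis
    by (simp add: invertible_det_nz[symmetric] invertible_left_inverse matrix_left_invertible_ker)
qed

text \<open>
  Dividing \<open>det_shifted_column\<close> by \<open>lam - t\<close> and letting \<open>t\<close> tend to \<open>lam\<close> expresses \<open>r lam\<close> by the
  nonzero determinant of \<open>det_eigenvector_column_nonzero\<close>.
\<close>

lemma principal_root_simple:
  assumes split: "\<And>t. det (A - mat t) = (lam - t) * r t" and r: "continuous_on UNIV r"
  shows "r lam \<noteq> 0"
proof -
  fix z
  have "\<phi> $ z * r lam = det (replace_column (A - mat lam) z \<phi>)"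
  proof (rule left_limit_eq[of "\<lambda>t. \<phi> $ z * r t"
        "\<lambda>t. det (replace_column (A - mat t) z \<phi>)" "lam - 1"])
    show "continuous_on UNIV (\<lambda>t. \<phi> $ z * r t)"
      using r by (intro continuous_intros)
    show "continuous_on UNIV (\<lambda>t. det (replace_column (A - mat t) z \<phi>))"
      by (rule continuous_on_shifted_cramer)
    show "\<phi> $ z * r t = det (replace_column (A - mat t) z \<phi>)" if "lam - 1 \<le> t" "t < lam" for t
      using det_shifted_column[of z t] split[of t] that by simp
  qed simp
  then show ?thesis
    using det_eigenvector_column_nonzero[of z] by auto
qed

text \<open>
  The function \<open>D\<close> collects the Cramer determinants of \<open>(A - t) f = c\<close> for the killing rates \<open>c\<close>. They
  are compared between \<open>t = 0\<close>, where they equal \<open>det A = lam * r 0\<close>, and \<open>t = lam\<close>, where they form a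
  multiple of \<open>\<phi>\<close> determined by pairing with \<open>\<phi>\<close>. All the facts at \<open>lam\<close>, where \<open>A - t\<close> is singular, are
  limits from the left.
\<close>

lemma eigenvector_max_bound:
  assumes lam: "0 < lam" and killing: "\<And>i. 0 \<le> (A *v (\<chi> j. 1)) $ i"
    and split: "\<And>t. det (A - mat t) = (lam - t) * r t" and r: "continuous_on UNIV r"
  shows "\<phi> $ x * (\<Sum>i\<in>UNIV. \<eta> i * \<phi> $ i) * r lam \<le> r 0 * (\<Sum>i\<in>UNIV. \<eta> i * (\<phi> $ i)\<^sup>2)"
proof -
  define c where "c = A *v (\<chi> j. 1)"
  define D where "D t = (\<chi> x. det (replace_column (A - mat t) x c))" for t
  have contD: "continuous_on UNIV (\<lambda>t. D t $ x)" for x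
    unfolding D_def vec_lambda_beta by (rule continuous_on_shifted_cramer)
  have le: "D t $ x \<le> lam * r 0" if t: "0 \<le> t" "t < lam" for t x
  proof -
    have shift: "mat t = diag_matrix (\<chi> i. t)"
      by (simp add: mat_def diag_matrix_def vec_eq_iff)
    have "D t $ x \<le> det (replace_column A x c)"
      unfolding D_def shift vec_lambda_beta
    proof (rule m_matrix_cramer_diagonal_mono[OF z_matrix _ phi_pos])
      show "0 < ((A - diag_matrix (\<chi> i. t)) *v \<phi>) $ i" for i
        using t phi_pos[of i] unfolding shift[symmetric]
        by (simp add: shifted_image eigenvector)
    qed (use t killing in \<open>auto simp: c_def\<close>)
    also have "\<dots> = det A"
      by (simp add: c_def det_replace_column_image)
    also have "det A = lam * r 0"
    proof -
      have "(A - mat 0) = A"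
        by (simp add: vec_eq_iff mat_def)
      then show ?thesis
        using split[of 0] by simp
    qed
    finally show ?thesis .
  qed
  have cramer: "(A *v D t) $ i - t * D t $ i = (lam - t) * r t * c $ i" if t: "t < lam" for t i
  proof -
    have nz: "det (A - mat t) \<noteq> 0"
      using root_imp_minor_eigenvalue minor_eigenvalue_lower_bound(1) t by force
    obtain f where f: "(A - mat t) *v f = c"
      using solve_linear_system[OF nz] by blast
    have "D t = det (A - mat t) *\<^sub>R f"
      using det_replace_column_image[of "A - mat t" _ f] f by (simp add: D_def vec_eq_iff mult.commute)
    then have "(A - mat t) *v D t = det (A - mat t) *\<^sub>R c"
      by (simp add: matrix_vector_mult_scaleR f)
    then have "(A *v D t - t *\<^sub>R D t) $ i = (det (A - mat t) *\<^sub>R c) $ i"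
      by (simp add: shifted_image)
    then show ?thesis
      by (simp add: split)
  qed
  have "(A *v D lam) $ i - lam * D lam $ i = (lam - lam) * r lam * c $ i" for i
  proof (rule left_limit_eq[of "\<lambda>t. (A *v D t) $ i - t * D t $ i"
        "\<lambda>t. (lam - t) * r t * c $ i" 0])
    show "continuous_on UNIV (\<lambda>t. (A *v D t) $ i - t * D t $ i)"
      unfolding matrix_vector_nth by (intro continuous_intros contD)
    show "continuous_on UNIV (\<lambda>t. (lam - t) * r t * c $ i)"
      by (intro continuous_intros r)
  qed (use lam cramer in auto)
  then have "(A *v D lam) $ i \<le> lam * D lam $ i" for i
    by simp
  then obtain \<beta> where \<beta>: "D lam = \<beta> *\<^sub>R \<phi>"
    using subsolution_proportional by blast
  have pairing: "(\<Sum>i\<in>UNIV. \<eta> i * \<phi> $ i * D t $ i) = r t * (lam * (\<Sum>i\<in>UNIV. \<eta> i * \<phi> $ i))"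
    if t: "t < lam" for t
  proof -
    have "(lam - t) * (\<Sum>i\<in>UNIV. \<eta> i * \<phi> $ i * D t $ i) =
        (\<Sum>i\<in>UNIV. \<eta> i * \<phi> $ i * ((A *v D t) $ i - t * D t $ i))"
      using eigenvector_pairing[of "D t"]
      by (simp add: algebra_simps sum_subtractf sum_distrib_left)
    also have "\<dots> = (lam - t) * (r t * (\<Sum>i\<in>UNIV. \<eta> i * \<phi> $ i * c $ i))"
      by (simp add: cramer[OF t] sum_distrib_left mult_ac)
    also have "(\<Sum>i\<in>UNIV. \<eta> i * \<phi> $ i * c $ i) = lam * (\<Sum>i\<in>UNIV. \<eta> i * \<phi> $ i)"
      using eigenvector_pairing[of "\<chi> j. 1"] by (simp add: c_def)
    finally show ?thesis
      using t by simp
  qed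
  have "(\<Sum>i\<in>UNIV. \<eta> i * \<phi> $ i * D lam $ i) = r lam * (lam * (\<Sum>i\<in>UNIV. \<eta> i * \<phi> $ i))"
    by (rule left_limit_eq[of "\<lambda>t. \<Sum>i\<in>UNIV. \<eta> i * \<phi> $ i * D t $ i"
          "\<lambda>t. r t * (lam * (\<Sum>i\<in>UNIV. \<eta> i * \<phi> $ i))" 0])
       (use lam pairing in \<open>auto intro!: continuous_intros contD r\<close>)
  then have beta: "\<beta> * (\<Sum>i\<in>UNIV. \<eta> i * (\<phi> $ i)\<^sup>2) = lam * (r lam * (\<Sum>i\<in>UNIV. \<eta> i * \<phi> $ i))"
    by (simp add: \<beta> sum_distrib_left power2_eq_square mult_ac)
  have "D lam $ x \<le> lam * r 0"
    by (rule left_limit_le[of "\<lambda>t. D t $ x" "\<lambda>t. lam * r 0" 0]) (use lam le contD in auto)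
  then have "\<beta> * \<phi> $ x * (\<Sum>i\<in>UNIV. \<eta> i * (\<phi> $ i)\<^sup>2) \<le> lam * r 0 * (\<Sum>i\<in>UNIV. \<eta> i * (\<phi> $ i)\<^sup>2)"
    using eigenvector_norm_pos by (simp add: \<beta>)
  then have "\<phi> $ x * (lam * (r lam * (\<Sum>i\<in>UNIV. \<eta> i * \<phi> $ i))) \<le> lam * r 0 * (\<Sum>i\<in>UNIV. \<eta> i * (\<phi> $ i)\<^sup>2)"
    unfolding beta[symmetric] by (simp add: mult_ac)
  then have "lam * (\<phi> $ x * (\<Sum>i\<in>UNIV. \<eta> i * \<phi> $ i) * r lam) \<le>
      lam * (r 0 * (\<Sum>i\<in>UNIV. \<eta> i * (\<phi> $ i)\<^sup>2))"
    by (simp add: mult_ac)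
  then show ?thesis
    using lam by simp
qed

lemma principal_below_minors:
  assumes "UNIV - {y} \<noteq> {}"
  shows "lam < Min {\<mu>. minor_eigenvalue A (UNIV - {y}) \<mu>}"
  using least_minor_eigenvalue_le_rayleigh(2)[OF assms, where f = 0]
  by (intro minor_eigenvalue_lower_bound(2)) auto

text \<open>
  With \<open>m = \<phi> y\<close>, \<open>f = \<phi> - m\<close> and \<open>s = lam / \<mu>\<close>, the Rayleigh bound for \<open>f\<close> on the complement of \<open>y\<close> reads
  \<open>E \<le> s * (P - m * Q)\<close>, where \<open>E\<close> is the weighted square norm of \<open>f\<close> and \<open>P - m * Q\<close> its pairing with \<open>\<phi>\<close>.
  Expanding the square norm of \<open>f - s * \<phi>\<close>, which is nonnegative, then gives \<open>P - m * Q \<le> s * P\<close>.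
\<close>

lemma eigenvector_min_bound:
  assumes lam: "0 < lam" and killing: "\<And>i. 0 \<le> (A *v (\<chi> j. 1)) $ i"
    and min: "\<And>i. \<phi> $ y \<le> \<phi> $ i"
    and \<mu>: "\<mu> = Min {\<mu>. minor_eigenvalue A (UNIV - {y}) \<mu>}" and ne: "UNIV - {y} \<noteq> {}"
  shows "(1 - lam / \<mu>) * (\<Sum>i\<in>UNIV. \<eta> i * (\<phi> $ i)\<^sup>2) \<le> \<phi> $ y * (\<Sum>i\<in>UNIV. \<eta> i * \<phi> $ i)"
proof -
  define m where "m = \<phi> $ y"
  define f where "f = \<phi> - m *\<^sub>R (\<chi> j. 1)"
  define P where "P = (\<Sum>i\<in>UNIV. \<eta> i * (\<phi> $ i)\<^sup>2)"
  define Q where "Q = (\<Sum>i\<in>UNIV. \<eta> i * \<phi> $ i)"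
  define E where "E = (\<Sum>i\<in>UNIV. \<eta> i * (f $ i)\<^sup>2)"
  have f0: "0 \<le> f $ i" for i
    using min[of i] by (simp add: f_def m_def)
  have supp: "f $ i = 0" if "i \<notin> UNIV - {y}" for i
    using that by (simp add: f_def m_def)
  have gap: "lam < \<mu>"
    using principal_below_minors[OF ne] by (simp add: \<mu>)
  have "\<mu> * E \<le> (\<Sum>i\<in>UNIV. \<eta> i * f $ i * (A *v f) $ i)"
    using least_minor_eigenvalue_le_rayleigh(1)[OF ne supp] by (simp add: \<mu> E_def)
  also have "\<dots> \<le> (\<Sum>i\<in>UNIV. \<eta> i * f $ i * (lam * \<phi> $ i))"
  proof (intro sum_mono mult_left_mono)
    fix i
    have "0 \<le> m * (A *v (\<chi> j. 1)) $ i"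
      using killing[of i] phi_pos[of y] by (simp add: m_def)
    then show "(A *v f) $ i \<le> lam * \<phi> $ i"
      by (simp add: f_def matrix_vector_mult_diff_distrib matrix_vector_mult_scaleR eigenvector)
    show "0 \<le> \<eta> i * f $ i"
      using f0[of i] eta_pos[of i] by simp
  qed
  also have "\<dots> = lam * (P - m * Q)"
    by (simp add: f_def P_def Q_def algebra_simps sum_subtractf sum_distrib_left power2_eq_square)
  finally have muE: "\<mu> * E \<le> lam * (P - m * Q)" .
  define s where "s = lam / \<mu>"
  have s: "0 < s"
    using lam gap by (simp add: s_def)
  have E: "E \<le> s * (P - m * Q)"
    using muE lam gap by (simp add: s_def field_simps)
  have "0 \<le> (\<Sum>i\<in>UNIV. \<eta> i * (f $ i - s * \<phi> $ i)\<^sup>2)"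
    using eta_pos by (intro sum_nonneg) (auto simp: less_imp_le)
  also have "\<dots> = (\<Sum>i\<in>UNIV. \<eta> i * (f $ i)\<^sup>2 - 2 * s * (\<eta> i * (\<phi> $ i)\<^sup>2 - m * (\<eta> i * \<phi> $ i)) + s\<^sup>2 * (\<eta> i * (\<phi> $ i)\<^sup>2))"
    by (intro sum.cong) (simp_all add: f_def power2_eq_square algebra_simps)
  also have "\<dots> = E - 2 * s * (P - m * Q) + s\<^sup>2 * P"
    by (simp only: sum.distrib sum_subtractf sum_distrib_left[symmetric] E_def P_def Q_def)
  also have "\<dots> \<le> s * (s * P - (P - m * Q))"
    using E by (simp add: power2_eq_square algebra_simps)
  finally have "P - m * Q \<le> s * P"
    using s by (simp add: zero_le_mult_iff)
  then show "(1 - lam / \<mu>) * (\<Sum>i\<in>UNIV. \<eta> i * (\<phi> $ i)\<^sup>2) \<le> \<phi> $ y * (\<Sum>i\<in>UNIV. \<eta> i * \<phi> $ i)"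
    by (simp add: P_def Q_def s_def m_def algebra_simps)
qed

text \<open>
  All roots of the characteristic polynomial are real by diagonalisation and at least \<open>lam\<close> by the
  maximum principle, so \<open>lam\<close> is the head of the sorted list.
\<close>

lemma det_sorted_eigenvalues:
  defines "ev \<equiv> sorted_eigenvalues A"
  shows "det (A - mat t) = (lam - t) * (\<Prod>k = 1..CARD('n) - 1. ev ! k - t)"
    and "k < CARD('n) \<Longrightarrow> lam \<le> ev ! k"
proof -
  obtain d :: "'n \<Rightarrow> real" where d: "\<And>t. det (A - mat t) = (\<Prod>i\<in>UNIV. d i - t)"
    using diagonalization by blast
  have ev: "ev = sorted_list_of_multiset (image_mset d (mset_set UNIV))"
    unfolding ev_def by (rule sorted_eigenvalues_eqI[OF d])
  have mset: "mset ev = image_mset d (mset_set UNIV)"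
    by (simp add: ev)
  have len: "length ev = CARD('n)"
    using arg_cong[OF mset, of size] by simp
  have set: "set ev = range d"
    using arg_cong[OF mset, of set_mset] by simp
  have lower: "lam \<le> e" if "e \<in> set ev" for e
  proof -
    have "det (A - mat e) = 0"
      using that by (auto simp: d set)
    then show ?thesis
      using root_imp_minor_eigenvalue minor_eigenvalue_lower_bound(1) by blast
  qed
  then show "lam \<le> ev ! k" if "k < CARD('n)"
    using that len by simp
  have "det (A - mat lam) = 0"
    using det_shifted_column[of _ lam] phi_pos by (metis cancel_comm_monoid_add_class.diff_cancel mult_zero_left mult_eq_0_iff less_irrefl)
  then have "lam \<in> set ev"
    by (auto simp: d set)
  moreover have "sorted ev"
    by (simp add: ev)
  ultimately have first: "ev ! 0 = lam"
    using lower len by (metis in_set_conv_nth order_antisym sorted_nth_mono le0 nth_mem length_pos_if_in_set)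
  have "det (A - mat t) = prod_mset (image_mset (\<lambda>e. e - t) (mset ev))"
    by (simp add: d mset prod_unfold_prod_mset image_mset.compositionality comp_def)
  also have "\<dots> = prod_list (map (\<lambda>e. e - t) ev)"
    by (simp flip: prod_mset_prod_list)
  also have "\<dots> = (\<Prod>k = 0..<CARD('n). ev ! k - t)"
    by (simp add: prod.list_conv_set_nth len)
  also have "\<dots> = (lam - t) * (\<Prod>k = Suc 0..<CARD('n). ev ! k - t)"
    by (subst prod.atLeast_Suc_lessThan) (simp_all add: first)
  also have "{Suc 0..<CARD('n)} = {1..CARD('n) - 1}"
    by auto
  finally show "det (A - mat t) = (lam - t) * (\<Prod>k = 1..CARD('n) - 1. ev ! k - t)" .
qed

end

section \<open>The amplitude bound\<close>

theorem proposition3: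
  fixes L :: "real ^ ('a::finite option) ^ ('a option)"
    and \<eta> :: "'a \<Rightarrow> real" and \<phi> :: "real ^ 'a" and lambda0 :: real
  assumes "markov_generator L"
    and "irreducible_matrix (restriction L)"
    and "\<forall>x. L $ None $ x = 0"
    and "\<exists>x. L $ Some x $ None > 0"
    and "reversible_probability (restriction L) \<eta>"
    and "\<forall>x. \<phi> $ x > 0"
    and "restriction L *v \<phi> = (- lambda0) *\<^sub>R \<phi>"
  shows "amplitude \<phi> \<le>
    inverse ((1 - real_of_ereal (ereal lambda0 / lambda0' L)) *
      (\<Prod>k = 1..CARD('a) - 1. 1 - lambda0 / sorted_eigenvalues (- restriction L) ! k))"
proof -
  define A where "A = - restriction L"
  have A_nth: "A $ x $ y = - L $ Some x $ Some y" for x y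
    by (simp add: A_def restriction_def)
  have offdiag: "0 \<le> L $ Some x $ Some y" if "x \<noteq> y" for x y
    using assms(1) that by (auto simp: markov_generator_def)
  have killing_rate: "(A *v (\<chi> j. 1)) $ x = L $ Some x $ None" for x
  proof -
    have "(\<Sum>y\<in>UNIV. L $ Some x $ y) = 0"
      using assms(1) by (simp add: markov_generator_def)
    then have "L $ Some x $ None + (\<Sum>y\<in>UNIV. L $ Some x $ Some y) = 0"
      by (simp add: UNIV_option_conv sum.reindex)
    then show ?thesis
      by (simp add: matrix_vector_nth A_nth sum_negf)
  qed
  have killing: "0 \<le> (A *v (\<chi> j. 1)) $ x" for x
    using assms(1) by (simp add: killing_rate markov_generator_def)
  have edges: "{(u, v). u \<noteq> v \<and> A $ u $ v < 0} = {(u, v). u \<noteq> v \<and> restriction L $ u $ v > 0}"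
    by (simp add: A_def)
  have connected: "(x, y) \<in> {(u, v). u \<noteq> v \<and> A $ u $ v < 0}\<^sup>*" for x y
    using assms(2) unfolding irreducible_matrix_def edges by blast
  have balance: "\<eta> x * A $ x $ y = \<eta> y * A $ y $ x" for x y
    using assms(5) by (simp add: reversible_probability_def A_def)
  \<comment> \<open>Detailed balance carries positivity of \<open>\<eta>\<close> along the edges of the irreducible chain.\<close>
  have eta_pos: "0 < \<eta> x" for x
  proof -
    have eta: "(\<Sum>x\<in>UNIV. \<eta> x) = 1" "\<And>x. 0 \<le> \<eta> x"
      using assms(5) by (auto simp: reversible_probability_def)
    obtain x0 where "\<eta> x0 \<noteq> 0"
      using eta(1) by (metis sum.neutral zero_neq_one)
    then have "0 < \<eta> x0"
      using eta(2)[of x0] by simp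
    with connected[of x0 x] show ?thesis
    proof (induction rule: rtrancl_induct)
      case (step u v)
      then have "\<eta> u * A $ u $ v < 0"
        by (simp add: mult_pos_neg)
      then have "\<eta> v \<noteq> 0"
        using balance[of u v] by auto
      then show ?case
        using eta(2)[of v] by simp
    qed
  qed
  interpret reversible_eigenpair A \<phi> lambda0 \<eta>
  proof
    show "z_matrix A"
      using offdiag by (simp add: z_matrix_def A_nth)
    show "A *v \<phi> = lambda0 *\<^sub>R \<phi>"
    proof -
      have "A *v \<phi> = - (restriction L *v \<phi>)"
        by (simp add: A_def matrix_vector_nth vec_eq_iff sum_negf)
      then show ?thesis
        by (simp add: assms(7))
    qed
  qed (use connected assms(6) eta_pos balance in auto)
  define P where "P = (\<Sum>i\<in>UNIV. \<eta> i * (\<phi> $ i)\<^sup>2)"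
  define Q where "Q = (\<Sum>i\<in>UNIV. \<eta> i * \<phi> $ i)"
  have P: "0 < P"
    using eigenvector_norm_pos by (simp add: P_def)
  have Q: "0 < Q"
    unfolding Q_def using eta_pos phi_pos by (intro sum_pos mult_pos_pos) auto
  have lam: "0 < lambda0"
  proof -
    obtain x where "0 < (A *v (\<chi> j. 1)) $ x"
      using assms(4) by (auto simp: killing_rate)
    then have "0 < (\<Sum>i\<in>UNIV. \<eta> i * \<phi> $ i * (A *v (\<chi> j. 1)) $ i)"
      using eta_pos[of x] phi_pos[of x] eta_pos phi_pos killing
      by (intro sum_pos2[of _ x]) (auto simp: less_imp_le)
    then have "0 < lambda0 * Q"
      using eigenvector_pairing[of "\<chi> j. 1"] by (simp add: Q_def)
    then show ?thesis
      using Q by (simp add: zero_less_mult_iff)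
  qed
  define ev where "ev = sorted_eigenvalues A"
  define r where "r t = (\<Prod>k = 1..CARD('a) - 1. ev ! k - t)" for t
  have ev_ge: "lambda0 \<le> ev ! k" if "k \<in> {1..CARD('a) - 1}" for k
    using det_sorted_eigenvalues(2)[of k] that by (auto simp: ev_def)
  have split: "det (A - mat t) = (lambda0 - t) * r t" for t
    using det_sorted_eigenvalues(1) by (simp add: r_def ev_def)
  have cont: "continuous_on UNIV r"
    unfolding r_def by (intro continuous_intros)
  have "0 \<le> r lambda0"
    unfolding r_def using ev_ge by (intro prod_nonneg) simp
  moreover have "r lambda0 \<noteq> 0"
    by (rule principal_root_simple[OF split cont])
  ultimately have r_lam: "0 < r lambda0"
    by simp
  have r_0: "0 < r 0"
    unfolding r_def using ev_ge lam by (intro prod_pos) force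
  have product: "(\<Prod>k = 1..CARD('a) - 1. 1 - lambda0 / ev ! k) = r lambda0 / r 0"
    unfolding r_def prod_dividef[symmetric]
    using ev_ge lam by (intro prod.cong) (force simp: diff_divide_distrib)+
  obtain y where y: "\<And>i. \<phi> $ y \<le> \<phi> $ i"
    using ex_is_arg_min_if_finite[of UNIV "\<lambda>i. \<phi> $ i"] by (auto simp: is_arg_min_linorder)
  obtain x where x: "\<And>i. \<phi> $ i \<le> \<phi> $ x"
    using ex_is_arg_min_if_finite[of UNIV "\<lambda>i. - \<phi> $ i"] by (auto simp: is_arg_min_linorder)
  have amplitude: "amplitude \<phi> = \<phi> $ x / \<phi> $ y"
  proof -
    have "(MAX i. \<phi> $ i) = \<phi> $ x" "(MIN i. \<phi> $ i) = \<phi> $ y"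
      using x y by (auto intro!: Max_eqI Min_eqI)
    then show ?thesis
      by (simp add: amplitude_def)
  qed
  \<comment> \<open>No neighbour of \<open>y\<close> has a smaller value, so only killing can make \<open>(A \<phi>) y\<close> positive.\<close>
  have exit: "y \<in> exit_points L"
  proof -
    have "(A *v (\<phi> - (\<phi> $ y) *\<^sub>R (\<chi> j. 1))) $ y \<le> 0"
      using y by (intro z_matrix_row_touching[OF z_matrix]) auto
    then have "lambda0 * \<phi> $ y \<le> \<phi> $ y * L $ Some y $ None"
      by (simp add: matrix_vector_mult_diff_distrib matrix_vector_mult_scaleR eigenvector killing_rate)
    then have "lambda0 \<le> L $ Some y $ None"
      using phi_pos[of y] by (simp add: mult.commute)
    then show ?thesis
      using lam by (simp add: exit_points_def)
  qed
  define s where "s = real_of_ereal (ereal lambda0 / lambda0' L)"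
  have s: "s < 1 \<and> (1 - s) * P \<le> \<phi> $ y * Q"
  proof (cases "UNIV = {y}")
    case True
    \<comment> \<open>Here \<open>lambda0' L\<close> is infinite and the quotient \<open>s\<close> is zero.\<close>
    have "UNIV - {i} = {}" for i :: 'a
    proof -
      have "i = y"
        by (metis True UNIV_I singletonD)
      then show ?thesis
        unfolding True by simp
    qed
    then have "first_eigenvalue A (UNIV - {i}) = \<infinity>" for i
      by (simp add: first_eigenvalue_def)
    then have "lambda0' L = \<infinity>"
      unfolding lambda0'_def A_def[symmetric] using exit by (auto intro!: Min_eqI)
    moreover have "P = \<phi> $ y * Q"
      unfolding P_def Q_def True by (simp add: power2_eq_square)
    ultimately show ?thesis
      by (simp add: s_def)
  next
    case False
    define \<mu> where "\<mu> i = Min {\<mu>. minor_eigenvalue A (UNIV - {i}) \<mu>}" for i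
    have ne: "UNIV - {i} \<noteq> {}" for i :: 'a
    proof
      assume "UNIV - {i} = {}"
      then have "y = i" "UNIV = {i}"
        by auto
      then show False
        using False by simp
    qed
    have first: "first_eigenvalue A (UNIV - {i}) = ereal (\<mu> i)" for i
      using ne[of i] by (simp add: first_eigenvalue_def \<mu>_def)
    have gap: "lambda0 < \<mu> i" for i
      unfolding \<mu>_def by (rule principal_below_minors[OF ne])
    have "lambda0' L = Min ((\<lambda>i. ereal (\<mu> i)) ` exit_points L)"
      by (simp add: lambda0'_def A_def[symmetric] first)
    moreover have "Min ((\<lambda>i. ereal (\<mu> i)) ` exit_points L) \<in> (\<lambda>i. ereal (\<mu> i)) ` exit_points L"
      using exit by (intro Min_in) auto
    moreover have "Min ((\<lambda>i. ereal (\<mu> i)) ` exit_points L) \<le> ereal (\<mu> y)"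
      using exit by (intro Min_le) auto
    ultimately obtain i where i: "lambda0' L = ereal (\<mu> i)" "\<mu> i \<le> \<mu> y"
      by auto
    then have s_eq: "s = lambda0 / \<mu> i"
      using gap[of i] lam by (simp add: s_def)
    then have "s < 1"
      using gap[of i] lam by simp
    have "lambda0 / \<mu> y \<le> s"
      unfolding s_eq using i(2) gap[of i] lam by (intro divide_left_mono) auto
    then have "(1 - s) * P \<le> (1 - lambda0 / \<mu> y) * P"
      using P by (intro mult_right_mono) auto
    also have "\<dots> \<le> \<phi> $ y * Q"
      unfolding P_def Q_def by (rule eigenvector_min_bound[OF lam killing y \<mu>_def ne])
    finally show ?thesis
      using \<open>s < 1\<close> by simp
  qed
  have "\<phi> $ x * Q * r lambda0 \<le> r 0 * P"
    unfolding P_def Q_def by (rule eigenvector_max_bound[OF lam killing split cont])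
  then have "(1 - s) * (\<phi> $ x * Q * r lambda0) \<le> (1 - s) * (r 0 * P)"
    using s by (intro mult_left_mono) auto
  also have "\<dots> = r 0 * ((1 - s) * P)"
    by (rule mult.left_commute)
  also have "\<dots> \<le> r 0 * (\<phi> $ y * Q)"
    using s r_0 by (intro mult_left_mono) auto
  finally have "Q * ((1 - s) * \<phi> $ x * r lambda0) \<le> Q * (r 0 * \<phi> $ y)"
    by (simp add: mult_ac)
  then have "(1 - s) * \<phi> $ x * r lambda0 \<le> r 0 * \<phi> $ y"
    using Q by simp
  then have "\<phi> $ x / \<phi> $ y \<le> inverse ((1 - s) * (r lambda0 / r 0))"
    using s r_lam r_0 phi_pos[of y] by (simp add: field_simps)
  then show ?thesis
    unfolding amplitude s_def[symmetric] A_def[symmetric] ev_def[symmetric] product .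
qed

end
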